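(* Let $n,s_1,s_2$ be integers such that $0\le s_1<s_2<n$. Then $$\left(P_n^{s_1}-P_n^{s_2}\right)^{D}=\frac{1}{2\,(n\backslash(s_2-s_1))}\sum_{i=0}^{n-1}\rho^{*}_{n,s_2-s_1}(i+s_1)\,P_n^{i}.$$
   Context: Matrices are complex, with indices running over $[n]:=\{0,1,\dots,n-1\}$. $P_n$ is the $n\times n$ permutation matrix with $(P_n)_{i,j}=1$ if $j\equiv i+1\pmod n$ and $0$ otherwise; $P_n^0=I_n$. $(n,s)$ denotes the greatest common divisor and $n\backslash s:=n/(n,s)$. For integers $0<s<n$ and $i\in[n]$, there are unique $h\in[(n,s)]$ and $t\in[n\backslash s]$ with $i\equiv ts+h\pmod n$; put $\operatorname{cycle}_{n,s}(i):=h$ and $\operatorname{pos}_{n,s}(i):=t$. For an arbitrary integer argument, these functions are evaluated at its residue modulo $n$ in $[n]$. With $\delta$ the Kronecker delta, $$\rho^{*}_{n,s}(i):=\delta_{0,\operatorname{cycle}_{n,s}(i)}\,\left((n\backslash s)-2\operatorname{pos}_{n,s}(i)-1\right).$$ The index of a square matrix $A$ is the smallest non-negative integer $k$ such that $A^k$ and $A^{k+1}$ have the same column space. If $A$ has index $k$, its Drazin inverse $A^D$ is the unique matrix with $AA^D=A^DA$, $A^{k+1}A^D=A^k$ and $A^DAA^D=A^D$. *)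

theory Defs
  imports
    "Jordan_Normal_Form.VS_Connect"
    "HOL-Number_Theory.Cong"
begin

definition cyc_perm_mat :: "nat \<Rightarrow> complex mat" where
  "cyc_perm_mat n = mat n n (\<lambda>(i, j). if [j = i + 1] (mod n) then 1 else 0)"

definition gcd_quot :: "nat \<Rightarrow> nat \<Rightarrow> nat" where
  "gcd_quot n s = n div gcd n s"

text \<open>
  For \<open>0 < s < n\<close> exactly one pair \<open>(h, t)\<close> satisfies this predicate. It depends on \<open>i\<close> only
  modulo \<open>n\<close>, so allowing every integer \<open>i\<close> amounts to evaluating at its residue in \<open>{0..<n}\<close>.
\<close>
definition is_cycle_pos :: "nat \<Rightarrow> nat \<Rightarrow> int \<Rightarrow> nat \<times> nat \<Rightarrow> bool" where
  "is_cycle_pos n s i = (\<lambda>(h, t). h < gcd n s \<and> t < gcd_quot n s \<and>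
     [i = int t * int s + int h] (mod int n))"

definition cycle_of :: "nat \<Rightarrow> nat \<Rightarrow> int \<Rightarrow> nat" where
  "cycle_of n s i = fst (THE p. is_cycle_pos n s i p)"

definition pos_of :: "nat \<Rightarrow> nat \<Rightarrow> int \<Rightarrow> nat" where
  "pos_of n s i = snd (THE p. is_cycle_pos n s i p)"

definition rho_star :: "nat \<Rightarrow> nat \<Rightarrow> int \<Rightarrow> int" where
  "rho_star n s i =
     (if cycle_of n s i = 0 then 1 else 0) * (int (gcd_quot n s) - 2 * int (pos_of n s i) - 1)"

text \<open>The index and the Drazin inverse are meaningful for square matrices only.\<close>

definition mat_index :: "complex mat \<Rightarrow> nat" where
  "mat_index A = (LEAST k. vec_space.col_space (dim_row A) (A ^\<^sub>m k)
                         = vec_space.col_space (dim_row A) (A ^\<^sub>m (k + 1)))"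

definition is_drazin_inverse :: "complex mat \<Rightarrow> complex mat \<Rightarrow> bool" where
  "is_drazin_inverse A X \<longleftrightarrow>
     X \<in> carrier_mat (dim_row A) (dim_row A) \<and>
     A * X = X * A \<and>
     A ^\<^sub>m (mat_index A + 1) * X = A ^\<^sub>m mat_index A \<and>
     X * A * X = X"

definition drazin_inverse :: "complex mat \<Rightarrow> complex mat" where
  "drazin_inverse A = (THE X. is_drazin_inverse A X)"

end

theory Submission
  imports Defs
begin

text \<open>
  Polynomials in \<open>P\<close> are circulant matrices, whose product is the cyclic convolution of their
  symbols. Write \<open>s = s\<^sub>2 - s\<^sub>1\<close>, \<open>g\<close> for the gcd of \<open>n\<close> and \<open>s\<close>, and \<open>m = n / g\<close>.
  Multiplying the claimed inverse \<open>X\<close> by \<open>A = P\<^sup>s\<^sup>1 - P\<^sup>s\<^sup>2\<close> takes the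
  difference \<open>\<rho>\<^sup>*(k) - \<rho>\<^sup>*(k - s)\<close>, so \<open>A X\<close> is the circulant of
  \<open>[n dvd k] - [g dvd k] / m\<close>, that is, the identity minus the average of the powers of \<open>P\<^sup>s\<close>.
  This average is killed by \<open>A\<close> since \<open>g\<close> divides \<open>s\<close>, and by \<open>X\<close> since \<open>\<rho>\<^sup>*\<close> has mean
  zero, because \<open>\<rho>\<^sup>*(-s - k) = -\<rho>\<^sup>*(k)\<close>. Hence \<open>X\<close> is the group inverse of \<open>A\<close>, and
  this forces the index of \<open>A\<close> to be at most 1 and \<open>X\<close> to be the Drazin inverse.
\<close>

section \<open>Group inverses as Drazin inverses\<close>

lemma mat_eq_if_mult_vec_eq:
  fixes A B :: "'a :: comm_semiring_1 mat"
  assumes A: "A \<in> carrier_mat r c" and B: "B \<in> carrier_mat r c"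
    and eq: "\<And>v. v \<in> carrier_vec c \<Longrightarrow> A *\<^sub>v v = B *\<^sub>v v"
  shows "A = B"
proof (rule eq_matI)
  fix i j assume ij: "i < dim_row B" "j < dim_col B"
  then have "(A *\<^sub>v unit_vec c j) $ i = (B *\<^sub>v unit_vec c j) $ i"
    using eq by simp
  then show "A $$ (i, j) = B $$ (i, j)" using ij A B by simp
qed (use A B in auto)

text \<open>Since \<open>A * A * X = A\<close>, every \<open>A *\<^sub>v x\<close> is also
  \<open>A * A\<close> applied to \<open>X *\<^sub>v x\<close>, so \<open>A\<close> and its square
  have the same range. At index 0 the range of \<open>A\<close> is the whole space, and
  \<open>A * X\<close> fixes that range pointwise because \<open>A * X * A = A\<close>.\<close>

lemma mat_index_if_group_inverse:
  fixes A X Y :: "complex mat"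
  assumes A: "A \<in> carrier_mat n n" and X: "X \<in> carrier_mat n n"
    and comm: "A * X = X * A" and AXA: "A * X * A = A"
  shows "mat_index A \<le> 1"
    and "mat_index A = 0 \<Longrightarrow> A * X = 1\<^sub>m n"
proof -
  interpret vec_space "TYPE(complex)" n .
  have dim: "dim_row A = n" "dim_col A = n" using A by auto
  define P where "P k \<longleftrightarrow> col_space (A ^\<^sub>m k) = col_space (A ^\<^sub>m (k + 1))" for k
  have idx: "mat_index A = (LEAST k. P k)"
    by (simp add: mat_index_def P_def dim)
  have AAX: "A * A * X = A"
    using AXA assoc_mult_mat[OF A A X] assoc_mult_mat[OF A X A] comm by simp
  have pow1: "A ^\<^sub>m 1 = A" and pow2: "A ^\<^sub>m 2 = A * A"
    using A by (auto simp: numeral_2_eq_2)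
  have cs: "col_space B = {y\<in>carrier_vec n. \<exists>x\<in>carrier_vec n. B *\<^sub>v x = y}"
    if "B \<in> carrier_mat n n" for B
    using col_space_eq[OF that] that by auto
  have "col_space A \<subseteq> col_space (A * A)"
  proof
    fix y assume "y \<in> col_space A"
    then obtain x where x: "x \<in> carrier_vec n" "A *\<^sub>v x = y" "y \<in> carrier_vec n"
      using cs[OF A] by auto
    have "A * A *\<^sub>v (X *\<^sub>v x) = y"
      using assoc_mult_mat_vec[OF mult_carrier_mat[OF A A] X x(1)] x AAX by simp
    then show "y \<in> col_space (A * A)"
      using cs[of "A * A"] A X x by auto
  qed
  moreover have "col_space (A * A) \<subseteq> col_space A"
  proof
    fix y assume "y \<in> col_space (A * A)"
    then obtain x where x: "x \<in> carrier_vec n" "A * A *\<^sub>v x = y" "y \<in> carrier_vec n"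
      using cs[of "A * A"] A by auto
    have "A *\<^sub>v (A *\<^sub>v x) = y"
      using assoc_mult_mat_vec[OF A A x(1)] x by simp
    then show "y \<in> col_space A"
      using cs[OF A] A x by auto
  qed
  ultimately have P1: "P 1"
    using pow1 pow2 by (simp add: P_def)
  show "mat_index A \<le> 1"
    unfolding idx by (rule Least_le[of P, OF P1])
  assume "mat_index A = 0"
  then have "P 0" using LeastI[of P, OF P1] idx by simp
  then have full: "col_space (1\<^sub>m n) = col_space A"
    using dim pow1 by (simp add: P_def)
  show "A * X = 1\<^sub>m n"
  proof (rule mat_eq_if_mult_vec_eq)
    fix v :: "complex vec" assume v: "v \<in> carrier_vec n"
    then have "v \<in> col_space A" using full cs[of "1\<^sub>m n"] by auto
    then obtain u where u: "u \<in> carrier_vec n" "A *\<^sub>v u = v"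
      using cs[OF A] by auto
    have "A * X *\<^sub>v v = A * X * A *\<^sub>v u"
      using assoc_mult_mat_vec[OF mult_carrier_mat[OF A X] A u(1)] u by simp
    then show "A * X *\<^sub>v v = 1\<^sub>m n *\<^sub>v v"
      using AXA u v by simp
  qed (use A X in auto)
qed

text \<open>With index 0 or 1, the power equation is immediate for \<open>X\<close>, and for any
  candidate \<open>Y\<close> it yields \<open>A * A * Y = A\<close>. This makes \<open>A * X\<close>
  and \<open>Y * A\<close> coincide, after which \<open>X\<close> and \<open>Y\<close> both collapse
  to \<open>X * A * Y\<close>.\<close>

lemma drazin_inverse_eq_group_inverse:
  fixes A X :: "complex mat"
  assumes A: "A \<in> carrier_mat n n" and X: "X \<in> carrier_mat n n"
    and comm: "A * X = X * A" and AXA: "A * X * A = A" and XAX: "X * A * X = X"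
  shows "drazin_inverse A = X"
proof -
  have dim: "dim_row A = n" using A by auto
  note idx = mat_index_if_group_inverse[OF A X comm AXA]
  have AAX: "A * A * X = A"
    using AXA assoc_mult_mat[OF A A X] assoc_mult_mat[OF A X A] comm by simp
  have idx_cases: "mat_index A = 0 \<or> mat_index A = 1" using idx(1) by auto
  have pow: "A ^\<^sub>m 0 = 1\<^sub>m n" "A ^\<^sub>m 1 = A" "A ^\<^sub>m 2 = A * A"
    using A by (auto simp: numeral_2_eq_2)
  have "A ^\<^sub>m (mat_index A + 1) * X = A ^\<^sub>m mat_index A"
    using idx_cases
  proof
    assume "mat_index A = 0"
    then show ?thesis using idx(2) pow by simp
  next
    assume "mat_index A = 1"
    then show ?thesis using AAX pow by simp
  qed
  then have ex: "is_drazin_inverse A X"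
    using X comm XAX dim by (simp add: is_drazin_inverse_def)
  have "Y = X" if "is_drazin_inverse A Y" for Y
  proof -
    from that have Y: "Y \<in> carrier_mat n n" and AY: "A * Y = Y * A" and YAY: "Y * A * Y = Y"
      and pw: "A ^\<^sub>m (mat_index A + 1) * Y = A ^\<^sub>m mat_index A"
      by (auto simp: is_drazin_inverse_def dim)
    have AAY: "A * A * Y = A"
      using idx_cases
    proof
      assume "mat_index A = 0"
      then have "A * Y = 1\<^sub>m n" using pw A pow by simp
      then show ?thesis using assoc_mult_mat[OF A A Y] A by simp
    next
      assume "mat_index A = 1"
      then show ?thesis using pw pow by simp
    qed
    \<comment> \<open>One product is evaluated twice: \<open>A * A * X = A\<close> absorbs
      \<open>X\<close> and leaves \<open>Y * A\<close>, while commuting \<open>Y\<close> to the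
      right and using \<open>A * A * Y = A\<close> leaves \<open>A * X\<close>.\<close>
    have "Y * A * (A * X) = Y * A"
      using assoc_mult_mat[OF Y A mult_carrier_mat[OF A X]] assoc_mult_mat[OF A A X] AAX by simp
    moreover have "Y * A * (A * X) = A * X"
      using assoc_mult_mat[OF A Y mult_carrier_mat[OF A X]]
        assoc_mult_mat[OF Y A X] assoc_mult_mat[OF A Y A] assoc_mult_mat[OF A A Y]
        assoc_mult_mat[OF mult_carrier_mat[OF A Y] A X] AY AAY by simp
    ultimately have eq: "A * X = Y * A" by simp
    have "X = X * A * Y"
      using XAX eq AY assoc_mult_mat[OF X A X] assoc_mult_mat[OF X A Y] by simp
    also have "\<dots> = Y" using eq comm YAY by simp
    finally show "Y = X" by simp
  qed
  with ex show ?thesis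
    unfolding drazin_inverse_def by (rule the_equality)
qed

section \<open>Circulant matrices and cyclic convolution of their symbols\<close>

definition periodic :: "nat \<Rightarrow> (int \<Rightarrow> 'a) \<Rightarrow> bool" where
  "periodic n f \<longleftrightarrow> (\<forall>x y. [x = y] (mod int n) \<longrightarrow> f x = f y)"

text \<open>The symbol \<open>c\<close> lives on all integers because column minus row may be
  negative; periodicity is required separately.\<close>

definition circ :: "nat \<Rightarrow> (int \<Rightarrow> complex) \<Rightarrow> complex mat" where
  "circ n c = mat n n (\<lambda>(i, j). c (int j - int i))"

definition conv :: "nat \<Rightarrow> (int \<Rightarrow> complex) \<Rightarrow> (int \<Rightarrow> complex) \<Rightarrow> int \<Rightarrow> complex" where
  "conv n c d k = (\<Sum>i<n. c (int i) * d (k - int i))"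

text \<open>For natural \<open>a\<close> this is the symbol of the power
  \<open>cyc_perm_mat n ^\<^sub>m a\<close>; \<open>a = 0\<close> gives the unit of
  convolution.\<close>

definition delta :: "nat \<Rightarrow> int \<Rightarrow> int \<Rightarrow> complex" where
  "delta n a x = (if [x = a] (mod int n) then 1 else 0)"

lemma periodicD: "periodic n f \<Longrightarrow> [x = y] (mod int n) \<Longrightarrow> f x = f y"
  by (simp add: periodic_def)

lemma periodic_delta: "periodic n (delta n a)"
  by (auto simp: periodic_def delta_def cong_def)

lemma circ_carrier [simp]: "circ n c \<in> carrier_mat n n"
  by (simp add: circ_def)

text \<open>As \<open>u\<close> is its own inverse, k -> a + u k permutes the residues modulo
  \<open>n\<close>. The value 1 gives shifts of the index, -1 gives reflections.\<close>

lemma sum_periodic_affine: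
  fixes f :: "int \<Rightarrow> 'a :: comm_monoid_add"
  assumes f: "periodic n f" and u: "u * u = 1"
  shows "(\<Sum>i<n. f (a + u * int i)) = (\<Sum>i<n. f (int i))"
proof (cases "n = 0")
  case False
  define h where "h i = nat ((a + u * int i) mod int n)" for i
  have inj: "inj_on h {..<n}"
  proof
    fix i j assume ij: "i \<in> {..<n}" "j \<in> {..<n}" and "h i = h j"
    then have "[a + u * int i = a + u * int j] (mod int n)"
      using False by (simp add: h_def cong_def eq_nat_nat_iff)
    then have "[u * (u * int i) = u * (u * int j)] (mod int n)"
      by (auto intro: cong_scalar_left simp: cong_add_lcancel)
    then have "[int i = int j] (mod int n)"
      using u by (simp add: mult.assoc[symmetric])
    then show "i = j" using ij by (simp add: cong_def)
  qed
  have "h ` {..<n} \<subseteq> {..<n}"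
    using False by (auto simp: h_def nat_less_iff)
  with inj have bij: "bij_betw h {..<n} {..<n}"
    by (simp add: bij_betw_def endo_inj_surj)
  have "f (a + u * int i) = f (int (h i))" for i
    using False by (intro periodicD[OF f]) (simp add: h_def cong_def)
  then show ?thesis
    using sum.reindex_bij_betw[OF bij, of "\<lambda>i. f (int i)"] by simp
qed simp

lemma periodic_mult_reflect:
  fixes c d :: "int \<Rightarrow> 'a :: times"
  assumes c: "periodic n c" and d: "periodic n d"
  shows "periodic n (\<lambda>k. c k * d (x - k))"
  unfolding periodic_def
  by (intro allI impI arg_cong2[of _ _ _ _ "(*)"] periodicD[OF c] periodicD[OF d])
    (auto intro: cong_diff)

text \<open>By periodicity the inner index of the product can be shifted by the row index, after
  which only column minus row remains.\<close>

lemma circ_mult: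
  assumes c: "periodic n c" and d: "periodic n d"
  shows "circ n c * circ n d = circ n (conv n c d)"
proof (rule eq_matI)
  fix i j assume "i < dim_row (circ n (conv n c d))" "j < dim_col (circ n (conv n c d))"
  then have ij: "i < n" "j < n" by (auto simp: circ_def)
  have per: "periodic n (\<lambda>k. c k * d (int j - int i - k))"
    by (rule periodic_mult_reflect[OF c d])
  have "(circ n c * circ n d) $$ (i, j) = (\<Sum>k<n. c (int k - int i) * d (int j - int k))"
    using ij by (simp add: circ_def scalar_prod_def atLeast0LessThan)
  also have "\<dots> = (\<Sum>k<n. c (int k) * d (int j - int i - int k))"
    using sum_periodic_affine[OF per, of 1 "- int i"] by simp
  finally show "(circ n c * circ n d) $$ (i, j) = circ n (conv n c d) $$ (i, j)"
    using ij by (simp add: circ_def conv_def)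
qed (auto simp: circ_def)

lemma conv_commute:
  assumes c: "periodic n c" and d: "periodic n d"
  shows "conv n c d = conv n d c"
proof
  fix x
  have per: "periodic n (\<lambda>k. c k * d (x - k))"
    by (rule periodic_mult_reflect[OF c d])
  show "conv n c d x = conv n d c x"
    using sum_periodic_affine[OF per, of "-1" x] by (simp add: conv_def mult.commute)
qed

lemma delta_diff_eq:
  assumes "i < n" "j < n"
  shows "delta n 0 (int j - int i) = (if i = j then 1 else 0)"
proof -
  have "[int j - int i = 0] (mod int n) \<longleftrightarrow> [int j = int i] (mod int n)"
    by (simp add: cong_iff_dvd_diff)
  then show ?thesis using assms by (auto simp: delta_def cong_def)
qed

lemma conv_delta:
  assumes n: "n > 0" and d: "periodic n d"
  shows "conv n (delta n a) d x = d (x - a)"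
proof -
  have per: "periodic n (\<lambda>k. delta n a k * d (x - k))"
    by (rule periodic_mult_reflect[OF periodic_delta d])
  \<comment> \<open>Shifting the index by \<open>a\<close> moves the one surviving term to index
    0.\<close>
  have "conv n (delta n a) d x = (\<Sum>i<n. delta n a (a + int i) * d (x - (a + int i)))"
    using sum_periodic_affine[OF per, of 1 a] by (simp add: conv_def)
  also have "\<dots> = (\<Sum>i<n. if i = 0 then d (x - a) else 0)"
  proof (intro sum.cong refl)
    fix i assume "i \<in> {..<n}"
    then have "delta n a (a + int i) = (if i = 0 then 1 else 0)"
      using delta_diff_eq[of 0 n i] n by (simp add: delta_def cong_iff_dvd_diff)
    then show "delta n a (a + int i) * d (x - (a + int i)) = (if i = 0 then d (x - a) else 0)"
      by simp
  qed
  also have "\<dots> = d (x - a)" using n by simp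
  finally show ?thesis .
qed

lemma cyc_perm_mat_pow:
  assumes "n > 0"
  shows "cyc_perm_mat n ^\<^sub>m k = circ n (delta n (int k))"
proof (induction k)
  case 0
  show ?case
    by (rule eq_matI)
      (auto simp: circ_def delta_diff_eq cyc_perm_mat_def)
next
  case (Suc k)
  have 1: "cyc_perm_mat n = circ n (delta n 1)"
    by (rule eq_matI)
      (auto simp: circ_def delta_def cyc_perm_mat_def cong_iff_dvd_diff algebra_simps
        simp flip: cong_int_iff)
  have "conv n (delta n (int k)) (delta n 1) x = delta n (int (Suc k)) x" for x
    using assms by (simp add: conv_delta periodic_delta)
      (simp add: delta_def cong_iff_dvd_diff algebra_simps)
  then show ?case
    using Suc circ_mult[OF periodic_delta periodic_delta, of n "int k" 1]
    by (simp add: 1[symmetric]) presburger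
qed

section \<open>Finite sums in the additive group of matrices\<close>

lemma index_finsum_mat:
  assumes "finite S" and "\<And>i. i \<in> S \<Longrightarrow> f i \<in> carrier_mat r c" and ab: "a < r" "b < c"
  shows "(\<Oplus>\<^bsub>module_mat TYPE(complex) r c\<^esub>i\<in>S. f i) $$ (a, b) = (\<Sum>i\<in>S. f i $$ (a, b))"
proof -
  interpret abelian_group "module_mat TYPE(complex) r c" by (rule abelian_group_mat)
  show ?thesis using assms(1,2)
  proof (induction S)
    case empty
    then show ?case using ab by (simp add: module_mat_simps)
  next
    case (insert x S)
    have "f \<in> S \<rightarrow> carrier (module_mat TYPE(complex) r c)"
      "f x \<in> carrier (module_mat TYPE(complex) r c)"
      using insert by (auto simp: module_mat_simps)
    moreover from this(1) have "(\<Oplus>\<^bsub>module_mat TYPE(complex) r c\<^esub>i\<in>S. f i) \<in> carrier_mat r c"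
      using finsum_closed by (simp add: module_mat_simps)
    ultimately show ?case
      using insert ab by (simp add: module_mat_simps)
  qed
qed

lemma finsum_mat_carrier:
  assumes "\<And>i. i \<in> S \<Longrightarrow> f i \<in> carrier_mat r c"
  shows "(\<Oplus>\<^bsub>module_mat TYPE(complex) r c\<^esub>i\<in>S. f i) \<in> carrier_mat r c"
proof -
  interpret abelian_group "module_mat TYPE(complex) r c" by (rule abelian_group_mat)
  show ?thesis using finsum_closed[of f S] assms by (auto simp: module_mat_simps)
qed

section \<open>Cycles, positions and the values of \<open>rho_star\<close>\<close>

lemma is_cycle_pos_unique:
  assumes s: "0 < s" "s < n" and p: "is_cycle_pos n s i p" and q: "is_cycle_pos n s i q"
  shows "p = q"
proof -
  obtain h t h' t' where pq: "p = (h, t)" "q = (h', t')" by fastforce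
  define g where "g = gcd n s"
  have "g > 0" using s by (simp add: g_def)
  obtain m r where m: "n = g * m" "s = g * r" "coprime m r"
    using gcd_coprime_exists[of n s] s unfolding g_def by (metis gcd_eq_0_iff mult.commute not_less0)
  have "gcd_quot n s = n div g" by (simp add: gcd_quot_def g_def)
  then have quot: "gcd_quot n s = m" using m(1) \<open>g > 0\<close> by simp
  have hb: "h < g" "h' < g" "t < m" "t' < m"
    and ph: "[i = int t * int s + int h] (mod int n)" "[i = int t' * int s + int h'] (mod int n)"
    using p q pq quot by (auto simp: is_cycle_pos_def g_def)
  have eq: "[int t * int s + int h = int t' * int s + int h'] (mod int n)"
    using ph by (meson cong_sym cong_trans)
  \<comment> \<open>Modulo \<open>g\<close> both multiples of \<open>s\<close> vanish, which
    isolates \<open>h\<close>.\<close>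
  then have "[int t * int s + int h = int t' * int s + int h'] (mod int g)"
    by (rule cong_dvd_modulus) (simp add: m(1))
  then have "[int h = int h'] (mod int g)"
    by (simp add: m(2) cong_def mult.left_commute[of _ "int g"])
  then have h: "h = h'" using hb by (simp add: cong_def)
  with eq have "[int t * int s = int t' * int s] (mod int n)"
    by (simp add: cong_add_rcancel)
  \<comment> \<open>Once \<open>g\<close> is cancelled, coprimality of \<open>m\<close> and
    \<open>r\<close> determines \<open>t\<close> modulo \<open>m\<close>.\<close>
  then have "int g * int m dvd int g * ((int t - int t') * int r)"
    by (simp add: cong_iff_dvd_diff m(1,2) algebra_simps)
  then have "int m dvd (int t - int t') * int r"
    using \<open>g > 0\<close> by simp
  then have "int m dvd int t - int t'"
    using m(3) by (simp add: coprime_dvd_mult_left_iff)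
  then have "[int t = int t'] (mod int m)" by (simp add: cong_iff_dvd_diff)
  then have "t = t'" using hb by (simp add: cong_def)
  with h pq show ?thesis by simp
qed

text \<open>By Bezout some multiple of \<open>s\<close> is congruent to the gcd modulo
  \<open>n\<close>. Division of \<open>i\<close> by the gcd then gives the cycle as remainder, and
  the quotient times the Bezout factor gives the position. The second conjunct serves to recognise
  cycle 0 by divisibility.\<close>

lemma is_cycle_pos_exists:
  assumes s: "0 < s" "s < n"
  shows "\<exists>h t. is_cycle_pos n s i (h, t) \<and> [i = int h] (mod int (gcd n s))"
proof -
  define g where "g = gcd n s"
  have "g > 0" using s by (simp add: g_def)
  define m where "m = gcd_quot n s"
  have nm: "n = g * m" by (simp add: m_def gcd_quot_def g_def)
  have sg: "g dvd s" by (simp add: g_def)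
  have "m > 0" using nm s by (cases m) auto
  obtain x where x: "[int s * x = int g] (mod int n)"
    using cong_solve_int[of "int s" "int n"] by (auto simp: g_def gcd.commute)
  define h where "h = nat (i mod int g)"
  define t where "t = nat ((x * (i div int g)) mod int m)"
  have h: "int h = i mod int g" "h < g"
    using \<open>g > 0\<close> by (auto simp: h_def nat_less_iff)
  have t: "int t = (x * (i div int g)) mod int m" "t < m"
    using \<open>m > 0\<close> by (auto simp: t_def nat_less_iff)
  have "[int t = x * (i div int g)] (mod int m)" by (simp add: t cong_def)
  then have "int m dvd int t - x * (i div int g)" by (simp add: cong_iff_dvd_diff)
  \<comment> \<open>Multiplying by \<open>s\<close>, a multiple of \<open>g\<close>, lifts the
    congruence modulo \<open>m\<close> to one modulo \<open>n = g * m\<close>.\<close>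
  then have "int g * int m dvd int s * (int t - x * (i div int g))"
    using sg by (intro mult_dvd_mono) auto
  then have "[int t * int s = (int s * x) * (i div int g)] (mod int n)"
    by (simp add: nm cong_iff_dvd_diff algebra_simps)
  also have "[(int s * x) * (i div int g) = int g * (i div int g)] (mod int n)"
    using x by (rule cong_scalar_right)
  finally have "[int t * int s + int h = int g * (i div int g) + int h] (mod int n)"
    by (simp add: cong_add_rcancel)
  then have "[i = int t * int s + int h] (mod int n)"
    by (simp add: h cong_sym)
  moreover have "[i = int h] (mod int g)" by (simp add: h cong_def)
  ultimately show ?thesis
    using h(2) t(2) by (auto simp: is_cycle_pos_def g_def m_def)
qed

lemma rho_star_eqI:
  assumes "0 < s" "s < n" "is_cycle_pos n s i (h, t)"
  shows "rho_star n s i = (if h = 0 then int (gcd_quot n s) - 2 * int t - 1 else 0)"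
proof -
  have "(THE p. is_cycle_pos n s i p) = (h, t)"
    using assms is_cycle_pos_unique by blast
  then show ?thesis by (simp add: rho_star_def cycle_of_def pos_of_def)
qed

lemma rho_star_mult:
  assumes "0 < s" "s < n" "t < gcd_quot n s" "[i = int t * int s] (mod int n)"
  shows "rho_star n s i = int (gcd_quot n s) - 2 * int t - 1"
  using assms rho_star_eqI[of s n i 0 t] by (simp add: is_cycle_pos_def)

lemma rho_star_eq_0:
  assumes s: "0 < s" "s < n" and ndvd: "\<not> int (gcd n s) dvd i"
  shows "rho_star n s i = 0"
proof -
  obtain h t where ht: "is_cycle_pos n s i (h, t)" "[i = int h] (mod int (gcd n s))"
    using is_cycle_pos_exists[OF s] by blast
  then have "h \<noteq> 0" using ndvd by (metis cong_0_iff of_nat_0)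
  then show ?thesis using rho_star_eqI[OF s ht(1)] by simp
qed

lemma multiple_of_gcd_obtain:
  assumes s: "0 < s" "s < n" and dvd: "int (gcd n s) dvd i"
  obtains t where "t < gcd_quot n s" "[i = int t * int s] (mod int n)"
proof -
  obtain h t where ht: "is_cycle_pos n s i (h, t)" "[i = int h] (mod int (gcd n s))"
    using is_cycle_pos_exists[OF s] by blast
  then have "int (gcd n s) dvd int h"
    using dvd cong_dvd_iff cong_sym by (metis cong_dvd_iff)
  then have "h = 0"
    using ht(1) by (auto simp: is_cycle_pos_def dest: nat_dvd_not_less)
  then show ?thesis using ht(1) that by (auto simp: is_cycle_pos_def)
qed

lemma periodic_rho_star: "periodic n (rho_star n s)"
proof -
  have "is_cycle_pos n s x = is_cycle_pos n s y" if "[x = y] (mod int n)" for x y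
    using that by (auto simp: is_cycle_pos_def cong_def fun_eq_iff)
  then show ?thesis
    by (simp add: periodic_def rho_star_def cycle_of_def pos_of_def)
qed

text \<open>With g the gcd, (n / g) s = n (s / g): a cycle closes after n / g steps of length
  \<open>s\<close>.\<close>

lemma gcd_quot_mult_cong_0: "[int (gcd_quot n s) * int s = 0] (mod int n)"
proof -
  have "n dvd gcd_quot n s * s"
    by (metis gcd_quot_def div_mult_swap dvd_triv_left gcd_dvd1 gcd_dvd2 dvd_div_mult mult.commute)
  then show ?thesis by (metis cong_0_iff of_nat_dvd_iff of_nat_mult)
qed

text \<open>Write m for \<open>gcd_quot n s\<close>. In cycle 0, subtracting \<open>s\<close> lowers
  the position by one and raises the value by 2, except at position 0, where it wraps around to m -
  1 and the value drops from m - 1 to 1 - m. Outside cycle 0 both values vanish.\<close>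

lemma rho_star_diff:
  assumes s: "0 < s" "s < n"
  shows "rho_star n s i - rho_star n s (i - int s) =
    (if int n dvd i then 2 * int (gcd_quot n s) else 0) - (if int (gcd n s) dvd i then 2 else 0)"
proof (cases "int (gcd n s) dvd i")
  case False
  moreover from this have "\<not> int (gcd n s) dvd i - int s"
    by (metis dvd_diff_commute dvd_diff_right_iff gcd_dvd2 of_nat_dvd_iff zdvd_zdiffD)
  moreover have "\<not> int n dvd i"
    using False by (meson dvd_trans gcd_dvd1 of_nat_dvd_iff)
  ultimately show ?thesis using rho_star_eq_0[OF s] by simp
next
  case True
  define m where "m = gcd_quot n s"
  from True obtain t where t: "t < m" "[i = int t * int s] (mod int n)"
    using multiple_of_gcd_obtain[OF s] unfolding m_def by metis
  have rho: "rho_star n s i = int m - 2 * int t - 1"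
    using rho_star_mult[OF s] t by (simp add: m_def)
  \<comment> \<open>The value of \<open>rho_star\<close> determines the position, so it suffices to
    compute it a second time with 0 in place of \<open>t\<close>.\<close>
  have zero: "int n dvd i \<longleftrightarrow> t = 0"
  proof
    assume "int n dvd i"
    then have "[i = int 0 * int s] (mod int n)" by (simp add: cong_0_iff)
    then have "rho_star n s i = int m - 2 * int 0 - 1"
      unfolding m_def using rho_star_mult[OF s, of 0] t by (simp add: m_def)
    with rho show "t = 0" by simp
  qed (use t in \<open>simp add: cong_0_iff\<close>)
  show ?thesis
  proof (cases "t = 0")
    case t0: True
    \<comment> \<open>Adding \<open>int m * int s\<close>, which is 0 modulo \<open>n\<close>, turns
      -s into the multiple of \<open>s\<close> at position \<open>m - 1\<close>.\<close>
    have "[i - int s = int m * int s - int s] (mod int n)"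
      using t t0 cong_diff[OF cong_trans[OF _ cong_sym[OF gcd_quot_mult_cong_0]] cong_refl]
      by (simp add: m_def)
    then have "[i - int s = int (m - 1) * int s] (mod int n)"
      using t by (simp add: of_nat_diff algebra_simps)
    then have "rho_star n s (i - int s) = int m - 2 * int (m - 1) - 1"
      using rho_star_mult[OF s, of "m - 1"] t by (simp add: m_def)
    then show ?thesis using rho zero t0 t True by (simp add: m_def of_nat_diff)
  next
    case False
    have "[i - int s = int t * int s - int s] (mod int n)"
      using t by (intro cong_diff) auto
    then have "[i - int s = int (t - 1) * int s] (mod int n)"
      using False by (simp add: of_nat_diff algebra_simps)
    then have "rho_star n s (i - int s) = int m - 2 * int (t - 1) - 1"
      using rho_star_mult[OF s, of "t - 1"] t by (simp add: m_def)
    then show ?thesis using rho zero False t True by (simp add: m_def of_nat_diff)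
  qed
qed

text \<open>The map i -> -s - i preserves cycle 0 and reverses it: position t becomes m - 1 - t,
  under which m - 2 t - 1 changes sign.\<close>

lemma rho_star_reflect:
  assumes s: "0 < s" "s < n"
  shows "rho_star n s (- int s - i) = - rho_star n s i"
proof (cases "int (gcd n s) dvd i")
  case False
  have "int (gcd n s) dvd - int s" by simp
  then have "\<not> int (gcd n s) dvd - int s - i"
    using False by (metis dvd_diff_right_iff)
  with False show ?thesis using rho_star_eq_0[OF s] by simp
next
  case True
  define m where "m = gcd_quot n s"
  from True obtain t where t: "t < m" "[i = int t * int s] (mod int n)"
    using multiple_of_gcd_obtain[OF s] unfolding m_def by metis
  \<comment> \<open>The explicit 0 is traded for \<open>int m * int s\<close>, so that the
    coefficient \<open>m - 1 - t\<close> is a natural number.\<close>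
  have "[0 - int s - i = int m * int s - int s - int t * int s] (mod int n)"
    using t(2) cong_sym[OF gcd_quot_mult_cong_0] unfolding m_def by (intro cong_diff) auto
  then have "[- int s - i = int (m - 1 - t) * int s] (mod int n)"
    using t(1) by (simp add: of_nat_diff algebra_simps)
  then have "rho_star n s (- int s - i) = int m - 2 * int (m - 1 - t) - 1"
    using rho_star_mult[OF s, of "m - 1 - t"] t by (simp add: m_def)
  moreover have "rho_star n s i = int m - 2 * int t - 1"
    using rho_star_mult[OF s] t by (simp add: m_def)
  ultimately show ?thesis using t(1) by (simp add: of_nat_diff)
qed

lemma sum_rho_star:
  assumes s: "0 < s" "s < n"
  shows "(\<Sum>i<n. rho_star n s (int i)) = 0"
proof -
  have "(\<Sum>i<n. rho_star n s (int i)) = (\<Sum>i<n. rho_star n s (- int s + (-1) * int i))"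
    by (rule sum_periodic_affine[OF periodic_rho_star, symmetric]) simp
  also have "\<dots> = - (\<Sum>i<n. rho_star n s (int i))"
    using rho_star_reflect[OF s] by (simp add: sum_negf)
  finally show ?thesis by simp
qed

section \<open>The group inverse of a difference of two powers, computed on symbols\<close>

theorem corollary6p8:
  fixes n s\<^sub>1 s\<^sub>2 :: nat
  assumes "s\<^sub>1 < s\<^sub>2" and "s\<^sub>2 < n"
  shows "drazin_inverse (cyc_perm_mat n ^\<^sub>m s\<^sub>1 - cyc_perm_mat n ^\<^sub>m s\<^sub>2) =
    (1 / (2 * of_nat (gcd_quot n (s\<^sub>2 - s\<^sub>1)))) \<cdot>\<^sub>m
    (\<Oplus>\<^bsub>module_mat TYPE(complex) n n\<^esub>i\<in>{0..<n}.
       of_int (rho_star n (s\<^sub>2 - s\<^sub>1) (int i + int s\<^sub>1)) \<cdot>\<^sub>m cyc_perm_mat n ^\<^sub>m i)"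
    (is "drazin_inverse ?A = ?X")
proof -
  define s where "s = s\<^sub>2 - s\<^sub>1"
  have s: "0 < s" "s < n" and n: "n > 0" and s2: "int s\<^sub>2 = int s + int s\<^sub>1"
    using assms by (auto simp: s_def)
  define m where "m = gcd_quot n s"
  define g where "g = gcd n s"
  have m: "m > 0"
    using n by (simp add: m_def gcd_quot_def div_greater_zero_iff gcd_le1_nat)
  \<comment> \<open>\<open>a\<close>, \<open>x\<close> and \<open>e\<close> are the symbols of
    \<open>?A\<close>, of \<open>?X\<close> and of their product.\<close>
  define a where "a k = delta n (int s\<^sub>1) k - delta n (int s\<^sub>2) k" for k
  define x where "x k = of_int (rho_star n s (k + int s\<^sub>1)) / (2 * of_nat m :: complex)" for k
  define e where "e k = delta n 0 k - (if int g dvd k then 1 / of_nat m else 0)" for k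
  have pa: "periodic n a"
    using periodic_delta by (simp add: periodic_def a_def)
  have px: "periodic n x"
    unfolding periodic_def x_def
    by (metis cong_add_rcancel periodicD[OF periodic_rho_star])
  have "g dvd n" by (simp add: g_def)
  \<comment> \<open>Divisibility by \<open>g\<close> is well defined on residues modulo
    \<open>n\<close>, which makes \<open>e\<close> periodic.\<close>
  then have g_cong: "int g dvd k \<longleftrightarrow> int g dvd l" if "[k = l] (mod int n)" for k l
    using that by (metis cong_dvd_iff cong_dvd_modulus of_nat_dvd_iff)
  then have pe: "periodic n e"
    using periodic_delta[of n 0] by (auto simp: periodic_def e_def)
  have A: "?A = circ n a"
    unfolding cyc_perm_mat_pow[OF n] by (rule eq_matI) (auto simp: circ_def a_def)
  have conv_a: "conv n a d k = d (k - int s\<^sub>1) - d (k - int s\<^sub>2)" if "periodic n d" for d k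
  proof -
    have "conv n a d k = conv n (delta n (int s\<^sub>1)) d k - conv n (delta n (int s\<^sub>2)) d k"
      by (simp add: conv_def a_def left_diff_distrib sum_subtractf)
    then show ?thesis using conv_delta[OF n that] by simp
  qed
  have S: "(\<Oplus>\<^bsub>module_mat TYPE(complex) n n\<^esub>i\<in>{0..<n}.
      of_int (rho_star n s (int i + int s\<^sub>1)) \<cdot>\<^sub>m cyc_perm_mat n ^\<^sub>m i) \<in> carrier_mat n n"
    by (rule finsum_mat_carrier) (simp add: cyc_perm_mat_pow[OF n])
  have X: "?X = circ n x"
  proof (rule eq_matI)
    fix i j assume "i < dim_row (circ n x)" "j < dim_col (circ n x)"
    then have ij: "i < n" "j < n" by (auto simp: circ_def)
    have per: "periodic n (\<lambda>k. of_int (rho_star n s (k + int s\<^sub>1)) :: complex)"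
      unfolding periodic_def by (metis cong_add_rcancel periodicD[OF periodic_rho_star])
    have "(\<Oplus>\<^bsub>module_mat TYPE(complex) n n\<^esub>i\<in>{0..<n}.
        of_int (rho_star n s (int i + int s\<^sub>1)) \<cdot>\<^sub>m cyc_perm_mat n ^\<^sub>m i) $$ (i, j) =
      (\<Sum>k<n. of_int (rho_star n s (int k + int s\<^sub>1)) * delta n (int k) (int j - int i))"
      using ij
      by (subst index_finsum_mat) (auto simp: cyc_perm_mat_pow[OF n] circ_def atLeast0LessThan)
    \<comment> \<open>Since \<open>delta n (int k) y\<close> equals
      \<open>delta n 0 (y - int k)\<close>, the sum is a convolution with the unit, up to the order
      of the factors.\<close>
    also have "\<dots> = conv n (delta n 0) (\<lambda>k. of_int (rho_star n s (k + int s\<^sub>1))) (int j - int i)"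
      unfolding conv_commute[OF periodic_delta per]
      by (auto simp: conv_def delta_def cong_iff_dvd_diff)
    also have "\<dots> = of_int (rho_star n s (int j - int i + int s\<^sub>1))"
      using conv_delta[OF n per] by simp
    finally have entry: "(\<Oplus>\<^bsub>module_mat TYPE(complex) n n\<^esub>i\<in>{0..<n}.
        of_int (rho_star n s (int i + int s\<^sub>1)) \<cdot>\<^sub>m cyc_perm_mat n ^\<^sub>m i) $$ (i, j) =
      of_int (rho_star n s (int j - int i + int s\<^sub>1))" .
    from S show "?X $$ (i, j) = circ n x $$ (i, j)"
      using entry ij by (simp add: circ_def x_def s_def[symmetric] m_def)
  next
    from S show "dim_row ?X = dim_row (circ n x)" "dim_col ?X = dim_col (circ n x)"
      by (auto simp: s_def circ_def)
  qed
  have ax: "conv n a x = e"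
  proof
    fix k
    \<comment> \<open>The offset \<open>s\<^sub>1\<close> inside \<open>x\<close> cancels the first
      shift in \<open>a\<close> and turns the second into a shift by \<open>s\<close>.\<close>
    have "conv n a x k =
      of_int (rho_star n s k - rho_star n s (k - int s)) / (2 * of_nat m)"
      using conv_a[OF px, of k] by (simp add: x_def s2 diff_divide_distrib)
    also have "\<dots> = e k"
      unfolding rho_star_diff[OF s] using m
      by (auto simp: e_def delta_def cong_0_iff g_def[symmetric] m_def[symmetric] field_simps)
    finally show "conv n a x k = e k" .
  qed
  have ae: "conv n a e = a"
  proof
    fix k
    have "int g dvd int s" by (simp add: g_def)
    \<comment> \<open>The two shifts differ by a multiple of \<open>g\<close>, so the averaging term
      of \<open>e\<close> cancels.\<close>
    then have "int g dvd k - int s\<^sub>1 \<longleftrightarrow> int g dvd k - int s\<^sub>2"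
      unfolding s2 by (metis diff_diff_eq2 diff_diff_add add.commute dvd_diff_left_iff)
    then show "conv n a e k = a k"
      using conv_a[OF pe] by (simp add: e_def a_def delta_def cong_iff_dvd_diff)
  qed
  have xe: "conv n x e = x"
  proof
    fix k
    have "conv n x e k = conv n x (delta n 0) k -
        (\<Sum>i<n. x (int i) * (if int g dvd k - int i then 1 / of_nat m else 0))"
      by (simp add: conv_def e_def right_diff_distrib sum_subtractf)
    also have "conv n x (delta n 0) k = x k"
      using conv_commute[OF px periodic_delta] conv_delta[OF n px] by simp
    \<comment> \<open>\<open>x\<close> vanishes at \<open>i\<close> unless \<open>g\<close> divides
      \<open>int i + int s\<^sub>1\<close>; for those \<open>i\<close> the condition on
      \<open>k - int i\<close> no longer depends on \<open>i\<close>. The indicator therefore leaves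
      the sum, and what remains is the vanishing total of \<open>rho_star\<close>.\<close>
    also have "(\<Sum>i<n. x (int i) * (if int g dvd k - int i then 1 / of_nat m else 0)) =
        (\<Sum>i<n. x (int i) * (if int g dvd k + int s\<^sub>1 then 1 / of_nat m else 0))"
    proof (intro sum.cong refl)
      fix i
      show "x (int i) * (if int g dvd k - int i then 1 / of_nat m else 0) =
        x (int i) * (if int g dvd k + int s\<^sub>1 then 1 / of_nat m else 0)"
      proof (cases "int g dvd int i + int s\<^sub>1")
        case True
        have "k + int s\<^sub>1 = (k - int i) + (int i + int s\<^sub>1)" by simp
        then have "int g dvd k - int i \<longleftrightarrow> int g dvd k + int s\<^sub>1"
          using True by (metis dvd_add_left_iff)
        then show ?thesis by simp
      next
        case False
        then show ?thesis using rho_star_eq_0[OF s] by (simp add: x_def g_def)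
      qed
    qed
    also have "\<dots> = (\<Sum>i<n. x (int i)) * (if int g dvd k + int s\<^sub>1 then 1 / of_nat m else 0)"
      by (simp add: sum_distrib_right)
    also have "(\<Sum>i<n. x (int i)) =
        of_int (\<Sum>i<n. rho_star n s (int s\<^sub>1 + 1 * int i)) / (2 * of_nat m)"
      by (simp add: x_def sum_divide_distrib add.commute)
    also have "(\<Sum>i<n. rho_star n s (int s\<^sub>1 + 1 * int i)) = 0"
      using sum_rho_star[OF s]
        sum_periodic_affine[OF periodic_rho_star, of 1 n s "int s\<^sub>1"] by simp
    finally show "conv n x e k = x k" by simp
  qed
  have xa: "conv n x a = e"
    using ax conv_commute[OF pa px] by simp
  show ?thesis
    unfolding A X
  \<comment> \<open>On symbols the three identities say that \<open>a\<close> and \<open>x\<close>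
    commute under convolution and that \<open>e\<close> fixes both.\<close>
  proof (rule drazin_inverse_eq_group_inverse[OF circ_carrier circ_carrier])
    show "circ n a * circ n x = circ n x * circ n a"
      using ax xa by (simp add: circ_mult pa px)
    show "circ n a * circ n x * circ n a = circ n a"
      using ax ae by (simp add: circ_mult pa px pe conv_commute[OF pe pa])
    show "circ n x * circ n a * circ n x = circ n x"
      using xa xe by (simp add: circ_mult pa px pe conv_commute[OF pe px])
  qed
qed

end
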